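(* Let $g(x)=\dfrac{x^2-1}{(x^2+1)(x^2+4)(x^2+9)}$ for $x\in\mathbb{R}$. For each $a\in\left\{\frac13,\frac12,\frac23,\frac34\right\}$ there exists $(\alpha,\beta)$ with $\alpha,\beta>0$ and $\alpha\beta=a$ such that the Gabor system $\mathcal G(g,\alpha,\beta)$ is not a frame for $L^2(\mathbb{R})$.
   Context: For $g\in L^2(\mathbb{R})$ nonzero and $\alpha,\beta>0$, the Gabor system is $\mathcal G(g,\alpha,\beta)=\{x\mapsto e^{2\pi i\beta m x}g(x-\alpha k): k,m\in\mathbb{Z}\}$. It is a (Gabor) frame for $L^2(\mathbb{R})$ if there exist constants $A,B>0$ such that for every $f\in L^2(\mathbb{R})$, $A\|f\|^2\le\sum_{m,k\in\mathbb{Z}}|\langle f,e^{2\pi i\beta m\cdot}g(\cdot-\alpha k)\rangle|^2\le B\|f\|^2$. *)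

theory Defs
  imports "HOL-Analysis.Analysis"
begin

text \<open>
  Elements of \<open>L\<^sup>2(\<real>)\<close> are represented by Borel measurable functions, not by classes modulo
  null sets. Every class has a Borel representative, and the notions below depend only on the
  class.
\<close>

definition L2 :: "(real \<Rightarrow> complex) set" where
  "L2 = {f \<in> borel_measurable lborel. integrable lborel (\<lambda>x. (cmod (f x))\<^sup>2)}"

definition L2_norm :: "(real \<Rightarrow> complex) \<Rightarrow> real" where
  "L2_norm f = sqrt (LINT x|lborel. (cmod (f x))\<^sup>2)"

definition L2_inner :: "(real \<Rightarrow> complex) \<Rightarrow> (real \<Rightarrow> complex) \<Rightarrow> complex" where
  "L2_inner f h = (LINT x|lborel. f x * cnj (h x))"

text \<open>
  The sum is taken in \<^typ>\<open>ennreal\<close>, where it always exists; the upper bound therefore includes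
  convergence.
\<close>

definition is_frame :: "('i \<Rightarrow> real \<Rightarrow> complex) \<Rightarrow> bool" where
  "is_frame e \<longleftrightarrow> (\<exists>A>0. \<exists>B>0. \<forall>f\<in>L2.
     ennreal (A * (L2_norm f)\<^sup>2) \<le> (\<Sum>\<^sub>\<infinity>i. ennreal ((cmod (L2_inner f (e i)))\<^sup>2)) \<and>
     (\<Sum>\<^sub>\<infinity>i. ennreal ((cmod (L2_inner f (e i)))\<^sup>2)) \<le> ennreal (B * (L2_norm f)\<^sup>2))"

definition gabor_system :: "(real \<Rightarrow> complex) \<Rightarrow> real \<Rightarrow> real \<Rightarrow> int \<times> int \<Rightarrow> real \<Rightarrow> complex" where
  "gabor_system g \<alpha> \<beta> = (\<lambda>(m, k) x. cis (2 * pi * \<beta> * of_int m * x) * g (x - \<alpha> * of_int k))"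

end

theory Submission
  imports Defs
begin

text \<open>
  Fix \<open>h = 1 / \<beta>\<close>. If the Gabor system is a frame, then for every base point \<open>x\<close> and every finitely
  supported sequence \<open>d\<close> the samples \<open>\<Sum>j. d j * g (x + j * h - \<alpha> * k)\<close>, for integers \<open>k\<close>, have an
  \<open>\<ell>\<^sup>2\<close>-norm bounded below by that of \<open>d\<close> (lemma \<open>gabor_frame_imp_lower_bound_on_samples\<close>). For a
  window with enough decay it follows that no bounded, persistently large sequence \<open>c\<close> makes all
  these samples vanish: cutting \<open>c\<close> off by wide tents would violate the lower bound (lemma
  \<open>gabor_not_frame_if_samples_annihilated\<close>). To exclude a frame it therefore suffices to find such
  a \<open>c\<close>, and for rational \<open>\<alpha> * \<beta>\<close> and a periodic or antiperiodic \<open>c\<close> there are only finitely many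
  different equations.

  The symmetry of the window \<open>g\<close> reduces these to a single one. Let
  \<open>Z h x = \<Sum>j. (- 1) ^ j * g (x + j * h)\<close>. It is even and changes sign under translation by \<open>h\<close>; hence,
  for \<open>h = 4 * t\<close> or \<open>h = 6 * t\<close>, the one equation \<open>Z h t = 0\<close> implies that \<open>Z h\<close> vanishes at
  all odd multiples of \<open>t\<close>. It has a solution by the intermediate value theorem: because \<open>g 1 = 0\<close>,
  while \<open>g\<close> is positive and decreasing on \<open>{3..}\<close>, the alternating sum is negative at \<open>t = 1\<close> and
  positive at \<open>t = 3\<close> (lemma \<open>exists_alternating_periodization_zero\<close>).

  With base point \<open>t\<close> and \<open>c j = (- 1) ^ j\<close>, the choice \<open>\<alpha> = 2 * t\<close> gives the product \<open>1/2\<close> for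
  \<open>h = 4 * t\<close> and \<open>1/3\<close> for \<open>h = 6 * t\<close>; keeping every other translate, that is \<open>\<alpha> = 4 * t\<close>, turns
  \<open>1/3\<close> into \<open>2/3\<close>. For \<open>3/4\<close> take \<open>\<alpha> = 3 * t\<close> and \<open>h = 4 * t\<close>, with base point \<open>0\<close> and the sequence
  \<open>0, 1, -1\<close> of period \<open>3\<close>: the equations again reduce to the vanishing of \<open>Z (6 * t)\<close> at odd
  multiples of \<open>t\<close>.
\<close>

section \<open>Sums over the integers\<close>

lemma summable_on_int_inverse_square:
  "(\<lambda>i::int. 1 / (1 + (of_int i)\<^sup>2 :: real)) summable_on UNIV"
proof -
  let ?f = "\<lambda>i::int. 1 / (1 + (of_int i)\<^sup>2 :: real)"
  have nat: "(\<lambda>n::nat. 1 / (1 + (of_nat n)\<^sup>2 :: real)) summable_on UNIV"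
  proof (rule norm_summable_imp_summable_on)
    have "summable (\<lambda>n::nat. inverse ((of_nat n :: real)\<^sup>2))"
      by (rule inverse_power_summable) simp
    then show "summable (\<lambda>n::nat. norm (1 / (1 + (of_nat n)\<^sup>2 :: real)))"
    proof (rule summable_comparison_test_ev[rotated])
      show "\<forall>\<^sub>F n in sequentially. norm (norm (1 / (1 + (of_nat n)\<^sup>2 :: real))) \<le> inverse ((of_nat n :: real)\<^sup>2)"
        using eventually_gt_at_top[of "0::nat"]
        by eventually_elim (auto simp: divide_simps add_pos_nonneg)
    qed
  qed
  have pos: "?f summable_on range int"
    by (subst summable_on_reindex) (use nat in \<open>simp_all add: o_def\<close>)
  have neg: "?f summable_on range (\<lambda>n. - int n)"
    by (subst summable_on_reindex) (use nat in \<open>simp_all add: o_def inj_def\<close>)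
  have "?f summable_on range int \<union> (range (\<lambda>n. - int n) - range int)"
    by (rule summable_on_Un_disjoint)
      (use pos neg in \<open>auto intro: summable_on_subset_banach\<close>)
  moreover have "range int \<union> (range (\<lambda>n. - int n) - range int) = UNIV"
    by (auto simp: image_iff) (metis int_cases2)
  ultimately show ?thesis by simp
qed

text \<open>
  Translating \<open>x\<close> by a multiple of \<open>h\<close> only relabels the terms, so \<open>x\<close> may be taken in one
  period, where the terms are comparable with \<open>1 / (1 + j\<^sup>2)\<close>. The uniformity in \<open>x\<close> is what
  makes the estimates below independent of the translate of the window.
\<close>

lemma sum_shifted_inverse_square_bounded:
  fixes h :: real
  assumes "h > 0"
  shows "\<exists>C. \<forall>x. \<forall>J::int set. finite J \<longrightarrow> (\<Sum>j\<in>J. 1 / (1 + (x + of_int j * h)\<^sup>2)) \<le> C"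
proof -
  define S where "S = (\<Sum>\<^sub>\<infinity>i::int. 1 / (1 + (of_int i)\<^sup>2 :: real))"
  define D where "D = 3 + 2 / h\<^sup>2"
  have "D \<ge> 0" unfolding D_def by simp
  have "(\<Sum>j\<in>J. 1 / (1 + (x + of_int j * h)\<^sup>2)) \<le> D * S" if "finite J" for x and J :: "int set"
  proof -
    \<comment> \<open>The relabelling: \<open>x + j * h\<close> lies within \<open>h\<close> of \<open>(j + n) * h\<close>.\<close>
    define n where "n = \<lfloor>x / h\<rfloor>"
    have *: "1 / (1 + (x + of_int j * h)\<^sup>2) \<le> D * (1 / (1 + (of_int (j + n))\<^sup>2))" for j
    proof -
      define y where "y = x + of_int j * h"
      define i :: real where "i = of_int (j + n)"
      have "of_int n \<le> x / h" "x / h < of_int n + 1" unfolding n_def by linarith+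
      moreover have "y / h = x / h + of_int j" using assms by (simp add: y_def field_simps)
      ultimately have "\<bar>i - y / h\<bar> \<le> 1" unfolding i_def by simp
      define z where "z = y / h"
      have "(i - z)\<^sup>2 \<le> 1" using \<open>\<bar>i - y / h\<bar> \<le> 1\<close> by (simp add: z_def abs_square_le_1)
      moreover have "0 \<le> (i - 2 * z)\<^sup>2" by simp
      moreover have "2 * (i - z)\<^sup>2 - (i - 2 * z)\<^sup>2 = i\<^sup>2 - 2 * z\<^sup>2"
        by (simp add: power2_eq_square algebra_simps)
      ultimately have "i\<^sup>2 \<le> 2 + 2 * (y / h)\<^sup>2" unfolding z_def by linarith
      then have "1 + i\<^sup>2 \<le> 3 + 2 / h\<^sup>2 * y\<^sup>2" by (simp add: power_divide)
      also have "\<dots> \<le> D * (1 + y\<^sup>2)" by (simp add: D_def distrib_left distrib_right)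
      finally show ?thesis
        unfolding y_def[symmetric] i_def[symmetric] by (simp add: divide_simps add_pos_nonneg)
    qed
    have "(\<Sum>j\<in>J. 1 / (1 + (x + of_int j * h)\<^sup>2)) \<le> (\<Sum>j\<in>J. D * (1 / (1 + (of_int (j + n))\<^sup>2)))"
      by (intro sum_mono *)
    also have "\<dots> = D * (\<Sum>i\<in>(\<lambda>j. j + n) ` J. 1 / (1 + (of_int i)\<^sup>2))"
      by (subst sum.reindex) (auto simp: inj_on_def sum_distrib_left)
    also have "\<dots> \<le> D * S"
      unfolding S_def
      by (intro mult_left_mono finite_sum_le_infsum summable_on_int_inverse_square)
        (use \<open>finite J\<close> \<open>D \<ge> 0\<close> in auto)
    finally show ?thesis .
  qed
  then show ?thesis by blast
qed

lemma summable_on_shifted_inverse_square: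
  fixes h x :: real
  assumes "h > 0"
  shows "(\<lambda>j::int. 1 / (1 + (x + of_int j * h)\<^sup>2)) summable_on UNIV"
proof -
  obtain C where C: "\<And>J::int set. finite J \<Longrightarrow> (\<Sum>j\<in>J. 1 / (1 + (x + of_int j * h)\<^sup>2)) \<le> C"
    using sum_shifted_inverse_square_bounded[OF assms] by blast
  show ?thesis
    by (rule nonneg_bdd_above_summable_on) (auto intro!: bdd_aboveI2[of _ _ C] C)
qed

lemma continuous_on_infsum_dominated:
  fixes f :: "'i \<Rightarrow> 'a::topological_space \<Rightarrow> 'b::banach"
  assumes "\<And>i. continuous_on T (f i)"
    and "\<And>i y. y \<in> T \<Longrightarrow> norm (f i y) \<le> M i"
    and "M summable_on UNIV"
  shows "continuous_on T (\<lambda>y. \<Sum>\<^sub>\<infinity>i. f i y)"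
proof (rule uniform_limit_theorem)
  show "uniform_limit T (\<lambda>X y. \<Sum>i\<in>X. f i y) (\<lambda>y. \<Sum>\<^sub>\<infinity>i. f i y) (finite_subsets_at_top UNIV)"
    by (rule Weierstrass_m_test_general) (use assms in auto)
qed (auto intro!: continuous_on_sum assms(1))

lemma summable_on_finite_sum:
  fixes f :: "'i \<Rightarrow> 'a \<Rightarrow> 'b::topological_comm_monoid_add"
  assumes "\<And>i. i \<in> I \<Longrightarrow> f i summable_on A"
  shows "(\<lambda>x. \<Sum>i\<in>I. f i x) summable_on A"
  using assms by (induction I rule: infinite_finite_induct) (auto intro: summable_on_add)

lemma infsum_int_symmetric:
  fixes f :: "int \<Rightarrow> real"
  assumes "f summable_on UNIV"
  shows "infsum f UNIV = f 0 + (\<Sum>n. f (int (Suc n)) + f (- int (Suc n)))"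
proof -
  let ?p = "\<lambda>n. int (Suc n)" and ?m = "\<lambda>n. - int (Suc n)"
  have on: "f summable_on A" for A using assms by (rule summable_on_subset_banach) simp
  have inj: "inj ?p" "inj ?m" by (auto simp: inj_def)
  have sp: "(f \<circ> ?p) summable_on UNIV" "(f \<circ> ?m) summable_on UNIV"
    using on summable_on_reindex[OF inj(1)] summable_on_reindex[OF inj(2)] by blast+
  have U: "UNIV = insert 0 (range ?p \<union> range ?m)"
  proof -
    have "i \<in> insert 0 (range ?p \<union> range ?m)" for i
    proof -
      have "i = 0 \<or> i = ?p (nat i - 1) \<or> i = ?m (nat (- i) - 1)" by linarith
      then show ?thesis by blast
    qed
    then show ?thesis by auto
  qed
  have "infsum f UNIV = infsum f ({0} \<union> (range ?p \<union> range ?m))"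
    by (subst U) simp
  also have "\<dots> = f 0 + infsum f (range ?p \<union> range ?m)"
    by (subst infsum_Un_disjoint) (auto simp: on)
  also have "infsum f (range ?p \<union> range ?m) = infsum f (range ?p) + infsum f (range ?m)"
    by (rule infsum_Un_disjoint) (auto simp: on)
  also have "\<dots> = infsum (f \<circ> ?p) UNIV + infsum (f \<circ> ?m) UNIV"
    using infsum_reindex[OF inj(1), of f] infsum_reindex[OF inj(2), of f] by simp
  also have "\<dots> = (\<Sum>\<^sub>\<infinity>n. f (?p n) + f (?m n))"
    using infsum_add[OF sp] by (simp add: o_def)
  also have "\<dots> = (\<Sum>n. f (?p n) + f (?m n))"
  proof -
    have "(\<lambda>n. f (?p n) + f (?m n)) summable_on UNIV"
      using summable_on_add[OF sp] by (simp add: o_def)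
    then show ?thesis
      by (intro sums_unique has_sum_imp_sums has_sum_infsum)
  qed
  finally show ?thesis .
qed

section \<open>Lower bounds of Gabor frames on samples\<close>

text \<open>
  Expand \<open>0 \<le> \<integral> \<bar>p - T\<bar>\<^sup>2\<close>, where \<open>T\<close> is the projection of \<open>p\<close> onto the span of the \<open>\<phi> i\<close>.
\<close>

lemma bessel_inequality:
  fixes p :: "'a \<Rightarrow> complex" and \<phi> :: "'i \<Rightarrow> 'a \<Rightarrow> complex" and h :: real
  assumes "finite I" and h: "h > 0"
    and p: "integrable M (\<lambda>x. p x * cnj (p x))"
    and p\<phi>: "\<And>i. i \<in> I \<Longrightarrow> integrable M (\<lambda>x. p x * cnj (\<phi> i x))"
    and \<phi>: "\<And>i j. i \<in> I \<Longrightarrow> j \<in> I \<Longrightarrow> integrable M (\<lambda>x. \<phi> i x * cnj (\<phi> j x))"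
    and orth: "\<And>i j. i \<in> I \<Longrightarrow> j \<in> I \<Longrightarrow> (LINT x|M. \<phi> i x * cnj (\<phi> j x)) = (if i = j then of_real h else 0)"
  shows "(\<Sum>i\<in>I. (cmod (LINT x|M. p x * cnj (\<phi> i x)))\<^sup>2) \<le> h * (LINT x|M. (cmod (p x))\<^sup>2)"
proof -
  define a where "a i = (LINT x|M. p x * cnj (\<phi> i x))" for i
  define T where "T x = (\<Sum>i\<in>I. a i / h * \<phi> i x)" for x
  define S where "S = (\<Sum>i\<in>I. (cmod (a i))\<^sup>2)"
  have \<phi>p: "integrable M (\<lambda>x. \<phi> i x * cnj (p x))" "(LINT x|M. \<phi> i x * cnj (p x)) = cnj (a i)" if "i \<in> I" for i
  proof -
    have eq: "(\<lambda>x. \<phi> i x * cnj (p x)) = (\<lambda>x. cnj (p x * cnj (\<phi> i x)))" by (simp add: mult.commute)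
    show "integrable M (\<lambda>x. \<phi> i x * cnj (p x))"
      unfolding eq by (intro integrable_cnj p\<phi> that)
    show "(LINT x|M. \<phi> i x * cnj (p x)) = cnj (a i)"
      unfolding eq a_def by (rule integral_bounded_linear[OF bounded_linear_cnj p\<phi>[OF that]])
  qed
  have S: "complex_of_real S = (\<Sum>i\<in>I. a i * cnj (a i))"
    by (simp add: S_def complex_norm_square[symmetric])
  have pT: "(\<lambda>x. p x * cnj (T x)) = (\<lambda>x. \<Sum>i\<in>I. cnj (a i) / h * (p x * cnj (\<phi> i x)))"
    by (simp add: T_def sum_distrib_left mult_ac)
  have Tp: "(\<lambda>x. T x * cnj (p x)) = (\<lambda>x. \<Sum>i\<in>I. a i / h * (\<phi> i x * cnj (p x)))"
    by (simp add: T_def sum_distrib_left sum_distrib_right mult_ac)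
  have TT: "(\<lambda>x. T x * cnj (T x)) = (\<lambda>x. \<Sum>i\<in>I. \<Sum>j\<in>I. a i * cnj (a j) / h\<^sup>2 * (\<phi> i x * cnj (\<phi> j x)))"
    by (simp add: T_def sum_product power2_eq_square mult_ac)
  have pT_int: "integrable M (\<lambda>x. p x * cnj (T x))"
    unfolding pT by (intro Bochner_Integration.integrable_sum integrable_mult_right p\<phi>)
  have Tp_int: "integrable M (\<lambda>x. T x * cnj (p x))"
    unfolding Tp by (intro Bochner_Integration.integrable_sum integrable_mult_right \<phi>p)
  have TT_int: "integrable M (\<lambda>x. T x * cnj (T x))"
    unfolding TT by (intro Bochner_Integration.integrable_sum integrable_mult_right \<phi>)
  have "(LINT x|M. p x * cnj (T x)) = (\<Sum>i\<in>I. cnj (a i) / h * a i)"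
    unfolding pT by (subst Bochner_Integration.integral_sum) (auto intro!: integrable_mult_right p\<phi> simp: a_def)
  then have I1: "(LINT x|M. p x * cnj (T x)) = S / h"
    by (simp add: S sum_divide_distrib mult_ac)
  have "(LINT x|M. T x * cnj (p x)) = (\<Sum>i\<in>I. a i / h * cnj (a i))"
    unfolding Tp by (subst Bochner_Integration.integral_sum) (auto intro!: integrable_mult_right \<phi>p simp: \<phi>p)
  then have I2: "(LINT x|M. T x * cnj (p x)) = S / h"
    by (simp add: S sum_divide_distrib mult_ac)
  have "(LINT x|M. T x * cnj (T x)) = (\<Sum>i\<in>I. \<Sum>j\<in>I. a i * cnj (a j) / h\<^sup>2 * (if i = j then h else 0))"
    unfolding TT
    by (subst Bochner_Integration.integral_sum, (intro Bochner_Integration.integrable_sum integrable_mult_right \<phi>; assumption),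
        intro sum.cong refl, subst Bochner_Integration.integral_sum)
       (auto intro!: integrable_mult_right \<phi> sum.cong simp: orth)
  also have "\<dots> = (\<Sum>i\<in>I. a i * cnj (a i) / h)"
    using \<open>finite I\<close> h by (intro sum.cong refl) (simp add: power2_eq_square if_distrib cong: if_cong)
  finally have I3: "(LINT x|M. T x * cnj (T x)) = S / h"
    by (simp add: S sum_divide_distrib)
  have "complex_of_real (LINT x|M. (cmod (p x - T x))\<^sup>2) = (LINT x|M. of_real ((cmod (p x - T x))\<^sup>2))"
    by (rule integral_complex_of_real[symmetric])
  also have "\<dots> = (LINT x|M. p x * cnj (p x) - p x * cnj (T x) - T x * cnj (p x) + T x * cnj (T x))"
    by (intro Bochner_Integration.integral_cong refl, subst complex_norm_square) (simp add: algebra_simps)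
  also have "\<dots> = (LINT x|M. p x * cnj (p x)) - S / h - S / h + S / h"
    using p pT_int Tp_int TT_int by (simp add: I1 I2 I3)
  also have "(LINT x|M. p x * cnj (p x)) = of_real (LINT x|M. (cmod (p x))\<^sup>2)"
    unfolding integral_complex_of_real[symmetric] complex_norm_square ..
  finally have "complex_of_real (LINT x|M. (cmod (p x - T x))\<^sup>2) = of_real ((LINT x|M. (cmod (p x))\<^sup>2) - S / h)"
    by simp
  then have "(LINT x|M. (cmod (p x))\<^sup>2) - S / h = (LINT x|M. (cmod (p x - T x))\<^sup>2)"
    by (metis of_real_eq_iff)
  also have "\<dots> \<ge> 0" by simp
  finally show ?thesis using h by (simp add: S_def a_def field_simps)
qed

lemma integral_exponential_over_period:
  fixes h :: real and n :: int
  assumes "h > 0"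
  shows "(LINT y|lborel. indicator {0..h} y *\<^sub>R cis (2 * pi * of_int n * y / h)) = (if n = 0 then of_real h else 0)"
proof (cases "n = 0")
  case True
  then show ?thesis using assms by (simp add: scaleR_conv_of_real)
next
  case False
  define w where "w = \<i> * of_real (2 * pi * of_int n / h)"
  have w: "w \<noteq> 0" using False assms by (simp add: w_def)
  have cis: "cis (2 * pi * of_int n * y / h) = exp (w * of_real y)" for y
    by (simp add: cis_conv_exp w_def mult_ac)
  have "(LINT y|lborel. indicator {0..h} y *\<^sub>R exp (w * of_real y)) = exp (w * of_real h) / w - exp (w * of_real 0) / w"
  proof (rule integral_FTC_Icc)
    fix x
    have "((\<lambda>z. exp (w * z) / w) has_field_derivative exp (w * of_real x)) (at (of_real x))"
      using w by (auto intro!: derivative_eq_intros)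
    then show "((\<lambda>y. exp (w * of_real y) / w) has_vector_derivative exp (w * of_real x)) (at x within {0..h})"
      by (intro has_vector_derivative_real_field)
  qed (use assms in \<open>auto intro!: continuous_intros\<close>)
  also have "exp (w * of_real h) = cis (2 * pi * of_int n)"
    using cis[of h] assms by simp
  also have "\<dots> = 1" by (simp add: cis_multiple_2pi)
  finally show ?thesis using False by (simp add: cis)
qed

text \<open>
  This is the necessary half of the Ron--Shen duality criterion, at a single point \<open>x0\<close>. The test
  function is \<open>d j\<close> on a short interval of length \<open>\<delta>\<close> to the right of \<open>x0 + j * h\<close>. Its inner
  products with the modulations of one translate of the window are Fourier coefficients, with
  respect to the period \<open>h\<close>, of the periodized product \<open>P k\<close>; Bessel's inequality sums them over the
  modulations, and \<open>\<delta> \<rightarrow> 0\<close> leaves the value of \<open>P k\<close> at \<open>0\<close>. A bound \<open>E\<close> of the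
  finite partial sums stands for the sum over \<open>k\<close>, so that no summability has to be shown first.
\<close>

lemma gabor_frame_imp_lower_bound_on_samples:
  fixes g :: "real \<Rightarrow> complex" and \<alpha> h x0 K :: real
  assumes "\<alpha> > 0" "h > 0"
    and cont: "continuous_on UNIV g"
    and decay: "\<And>x. cmod (g x) \<le> K / (1 + x\<^sup>2)"
    and frame: "is_frame (gabor_system g \<alpha> (1 / h))"
  obtains A where "A > 0"
    and "\<And>J d E. finite J \<Longrightarrow>
      (\<And>L. finite L \<Longrightarrow> (\<Sum>k\<in>L. (cmod (\<Sum>j\<in>J. d j * cnj (g (x0 + of_int j * h - \<alpha> * of_int k))))\<^sup>2) \<le> E) \<Longrightarrow>
      A * (\<Sum>j\<in>J. (cmod (d j))\<^sup>2) \<le> E"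
proof -
  obtain A where "A > 0"
    and A: "\<And>f. f \<in> L2 \<Longrightarrow> ennreal (A * (L2_norm f)\<^sup>2)
        \<le> (\<Sum>\<^sub>\<infinity>i. ennreal ((cmod (L2_inner f (gabor_system g \<alpha> (1 / h) i)))\<^sup>2))"
    using frame unfolding is_frame_def by blast
  have "A / h * (\<Sum>j\<in>J. (cmod (d j))\<^sup>2) \<le> E"
    if J: "finite J" and E: "\<And>L. finite L \<Longrightarrow> (\<Sum>k\<in>L. (cmod (\<Sum>j\<in>J. d j * cnj (g (x0 + of_int j * h - \<alpha> * of_int k))))\<^sup>2) \<le> E"
    for J d E
  proof (rule field_le_epsilon)
    fix \<epsilon> :: real assume "\<epsilon> > 0"
    have K: "K \<ge> 0" using order_trans[OF norm_ge_zero decay[of 0]] by simp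
    define s where "s j k = x0 + of_int j * h - \<alpha> * of_int k" for j k :: int
    define P where "P k y = (\<Sum>j\<in>J. d j * cnj (g (s j k + y)))" for k y
    have contP: "continuous_on T (P k)" for k T
      unfolding P_def
      by (intro continuous_intros continuous_on_compose2[OF cont]) auto
    define B where "B = (\<Sum>j\<in>J. cmod (d j)) * K"
    have PB: "cmod (P k y) \<le> B" for k y
    proof -
      have "cmod (P k y) \<le> (\<Sum>j\<in>J. cmod (d j) * K)"
        unfolding P_def
      proof (intro sum_norm_le)
        fix j
        have "cmod (g (s j k + y)) \<le> K / (1 + (s j k + y)\<^sup>2)" by (rule decay)
        also have "\<dots> \<le> K / 1" using K by (intro divide_left_mono) (auto simp: add_pos_nonneg)
        finally show "cmod (d j * cnj (g (s j k + y))) \<le> cmod (d j) * K"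
          by (simp add: norm_mult mult_left_mono)
      qed
      then show ?thesis by (simp add: B_def sum_distrib_right)
    qed
    have B: "B \<ge> 0" using PB[of 0 0] norm_ge_zero[of "P 0 0"] by linarith
    \<comment> \<open>A majorant \<open>M k\<close> of the squares that does not depend on \<open>y\<close>. One factor is estimated by the
        constant \<open>B\<close>, the other by the decay of the window, moved from \<open>s j k + y\<close> to \<open>s j k\<close>.\<close>
    define D where "D = K * (2 + 2 * h\<^sup>2)"
    define M where "M k = B * (\<Sum>j\<in>J. cmod (d j) * (D * (1 / (1 + (s j k)\<^sup>2))))" for k
    have PM: "(cmod (P k y))\<^sup>2 \<le> M k" if y: "y \<in> {0..h}" for k y
    proof -
      have "cmod (P k y) \<le> (\<Sum>j\<in>J. cmod (d j) * (D * (1 / (1 + (s j k)\<^sup>2))))"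
        unfolding P_def
      proof (intro sum_norm_le)
        fix j
        define u where "u = s j k"
        have "0 \<le> (u + 2 * y)\<^sup>2" by simp
        moreover have "y\<^sup>2 \<le> h\<^sup>2" using y by (intro power_mono) auto
        moreover have "2 * (u + y)\<^sup>2 + 2 * y\<^sup>2 - u\<^sup>2 = (u + 2 * y)\<^sup>2"
          by (simp add: power2_eq_square algebra_simps)
        ultimately have "1 + u\<^sup>2 \<le> 1 + 2 * h\<^sup>2 + 2 * (u + y)\<^sup>2" by linarith
        also have "\<dots> \<le> (2 + 2 * h\<^sup>2) * (1 + (u + y)\<^sup>2)" by (simp add: distrib_left distrib_right)
        finally have "1 / (1 + (u + y)\<^sup>2) \<le> (2 + 2 * h\<^sup>2) / (1 + u\<^sup>2)"
          by (simp add: divide_simps add_pos_nonneg mult.commute)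
        then have "K * (1 / (1 + (u + y)\<^sup>2)) \<le> K * ((2 + 2 * h\<^sup>2) / (1 + u\<^sup>2))"
          using K by (rule mult_left_mono)
        then have "cmod (g (u + y)) \<le> D * (1 / (1 + u\<^sup>2))"
          using decay[of "u + y"] by (simp add: D_def)
        then show "cmod (d j * cnj (g (s j k + y))) \<le> cmod (d j) * (D * (1 / (1 + (s j k)\<^sup>2)))"
          unfolding u_def norm_mult complex_mod_cnj by (intro mult_left_mono) auto
      qed
      then have "cmod (P k y) * cmod (P k y) \<le> M k"
        unfolding M_def using PB B by (intro mult_mono) auto
      then show ?thesis by (simp add: power2_eq_square)
    qed
    have sumM: "M summable_on UNIV"
    proof -
      have "(\<lambda>k. 1 / (1 + (s j k)\<^sup>2)) summable_on UNIV" for j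
      proof -
        have "(\<lambda>k::int. 1 / (1 + (- (x0 + of_int j * h) + of_int k * \<alpha>)\<^sup>2)) summable_on UNIV"
          by (rule summable_on_shifted_inverse_square[OF \<open>\<alpha> > 0\<close>])
        moreover have "(- (x0 + of_int j * h) + of_int k * \<alpha>)\<^sup>2 = (s j k)\<^sup>2" for k
          unfolding s_def by (simp add: power2_eq_square algebra_simps)
        ultimately show ?thesis by simp
      qed
      then show ?thesis unfolding M_def
        by (intro summable_on_cmult_right summable_on_finite_sum) auto
    qed
    \<comment> \<open>As \<open>\<Phi>\<close> is continuous, \<open>\<Phi> 0 \<le> E\<close> extends, up to \<open>\<epsilon>\<close>, to a short interval.\<close>
    define \<Phi> where "\<Phi> y = (\<Sum>\<^sub>\<infinity>k. (cmod (P k y))\<^sup>2)" for y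
    have sumP: "(\<lambda>k. (cmod (P k y))\<^sup>2) summable_on UNIV" if "y \<in> {0..h}" for y
      by (rule summable_on_comparison_test[OF sumM]) (use PM[OF that] in auto)
    have "continuous_on {0..h} \<Phi>"
      unfolding \<Phi>_def
      by (rule continuous_on_infsum_dominated[OF _ _ sumM]) (use PM in \<open>auto intro!: continuous_intros contP\<close>)
    moreover have "\<Phi> 0 \<le> E"
      unfolding \<Phi>_def using sumP[of 0] \<open>h > 0\<close> E
      by (intro infsum_le_finite_sums) (auto simp: P_def s_def)
    ultimately obtain \<delta>0 where "\<delta>0 > 0" and \<delta>0: "\<And>y. y \<in> {0..h} \<Longrightarrow> \<bar>y\<bar> < \<delta>0 \<Longrightarrow> \<Phi> y < E + \<epsilon>"
    proof -
      assume cont\<Phi>: "continuous_on {0..h} \<Phi>" and "\<Phi> 0 \<le> E"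
        and *: "\<And>\<delta>0. 0 < \<delta>0 \<Longrightarrow> (\<And>y. y \<in> {0..h} \<Longrightarrow> \<bar>y\<bar> < \<delta>0 \<Longrightarrow> \<Phi> y < E + \<epsilon>) \<Longrightarrow> thesis"
      from cont\<Phi> obtain r where "r > 0" "\<forall>y\<in>{0..h}. dist y 0 < r \<longrightarrow> dist (\<Phi> y) (\<Phi> 0) < \<epsilon>"
        unfolding continuous_on_iff using \<open>h > 0\<close> \<open>\<epsilon> > 0\<close> by (metis atLeastAtMost_iff less_imp_le order_refl)
      with \<open>\<Phi> 0 \<le> E\<close> show thesis
        by (intro *[of r]) (auto simp: dist_real_def abs_less_iff)
    qed
    define \<delta> where "\<delta> = min (h / 2) (\<delta>0 / 2)"
    have \<delta>: "\<delta> > 0" "\<delta> < h" "\<delta> < \<delta>0" using \<open>\<delta>0 > 0\<close> \<open>h > 0\<close> by (auto simp: \<delta>_def)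
    define b :: "int \<Rightarrow> real \<Rightarrow> real" where "b j = indicator {x0 + of_int j * h .. x0 + of_int j * h + \<delta>}" for j
    define f where "f x = (\<Sum>j\<in>J. b j x *\<^sub>R d j)" for x
    have b_meas [measurable]: "b j \<in> borel_measurable borel" for j
      unfolding b_def by measurable
    have b_int: "integrable lborel (b j)" "(LINT x|lborel. b j x) = \<delta>" for j
      using \<delta> by (simp_all add: b_def)
    \<comment> \<open>The intervals are disjoint because \<open>\<delta> < h\<close>.\<close>
    have b_disj: "b i x * b j x = (if i = j then b j x else 0)" for i j x
    proof (cases "i = j")
      case False
      have "\<not> (x \<in> {x0 + of_int i * h .. x0 + of_int i * h + \<delta>} \<and> x \<in> {x0 + of_int j * h .. x0 + of_int j * h + \<delta>})"
      proof
        assume "x \<in> {x0 + of_int i * h .. x0 + of_int i * h + \<delta>} \<and> x \<in> {x0 + of_int j * h .. x0 + of_int j * h + \<delta>}"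
        then have "of_int i * h < of_int (j + 1) * h" "of_int j * h < of_int (i + 1) * h"
          using \<delta> by (auto simp: algebra_simps)
        then have "i < j + 1" "j < i + 1"
          using \<open>h > 0\<close> by (simp_all only: mult_less_cancel_right_pos of_int_less_iff)
        with False show False by simp
      qed
      with False show ?thesis by (auto simp: b_def indicator_def)
    qed (auto simp: b_def indicator_def)
    have f2: "(cmod (f x))\<^sup>2 = (\<Sum>j\<in>J. (cmod (d j))\<^sup>2 * b j x)" for x
    proof -
      have "complex_of_real ((cmod (f x))\<^sup>2) = (\<Sum>i\<in>J. \<Sum>j\<in>J. of_real (b i x * b j x) * (d i * cnj (d j)))"
        unfolding complex_norm_square f_def
        by (simp add: sum_product scaleR_conv_of_real mult_ac)
      also have "\<dots> = (\<Sum>i\<in>J. \<Sum>j\<in>J. if i = j then of_real (b j x) * (d j * cnj (d j)) else 0)"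
        by (intro sum.cong refl) (simp add: b_disj)
      also have "\<dots> = (\<Sum>i\<in>J. of_real (b i x) * (d i * cnj (d i)))"
        using J by (intro sum.cong refl) simp
      also have "\<dots> = of_real (\<Sum>j\<in>J. (cmod (d j))\<^sup>2 * b j x)"
        by (simp add: complex_norm_square[symmetric] mult_ac flip: of_real_mult of_real_power)
      finally show ?thesis by (metis of_real_eq_iff)
    qed
    have "f \<in> L2"
    proof -
      have "f \<in> borel_measurable lborel" unfolding f_def[abs_def] by measurable
      moreover have "integrable lborel (\<lambda>x. (cmod (f x))\<^sup>2)"
        unfolding f2 by (intro Bochner_Integration.integrable_sum integrable_mult_right b_int)
      ultimately show ?thesis unfolding L2_def by simp
    qed
    have normf: "(L2_norm f)\<^sup>2 = \<delta> * (\<Sum>j\<in>J. (cmod (d j))\<^sup>2)"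
    proof -
      have "(L2_norm f)\<^sup>2 = (LINT x|lborel. (cmod (f x))\<^sup>2)"
        by (simp add: L2_norm_def)
      also have "\<dots> = (\<Sum>j\<in>J. (cmod (d j))\<^sup>2 * \<delta>)"
        unfolding f2 using b_int
        by (subst Bochner_Integration.integral_sum) auto
      finally show ?thesis by (simp add: sum_distrib_left mult.commute)
    qed
    define p where "p k y = indicator {0..\<delta>} y *\<^sub>R P k y" for k y
    define \<phi> :: "int \<Rightarrow> real \<Rightarrow> complex" where "\<phi> m y = indicator {0..h} y *\<^sub>R cis (2 * pi * of_int m * y / h)" for m y
    \<comment> \<open>Since \<open>h\<close> is a period of the modulations, all bumps can be moved to \<open>{0..\<delta>}\<close>; the position \<open>x0\<close>
        contributes only the phase \<open>c\<close>.\<close>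
    have inner: "cmod (L2_inner f (gabor_system g \<alpha> (1 / h) (m, k))) = cmod (LINT y|lborel. p k y * cnj (\<phi> m y))" for m k
    proof -
      define e where "e x = gabor_system g \<alpha> (1 / h) (m, k) x" for x
      define c where "c = cnj (cis (2 * pi * of_int m * x0 / h))"
      have e_shift: "cnj (e (x0 + of_int j * h + y)) = c * (cnj (cis (2 * pi * of_int m * y / h)) * cnj (g (s j k + y)))" for j y
      proof -
        have "cis (2 * pi * (1 / h) * of_int m * (x0 + of_int j * h + y))
            = cis (2 * pi * of_int m * x0 / h + 2 * pi * of_int m * y / h + 2 * pi * of_int (m * j))"
          using \<open>h > 0\<close> by (intro arg_cong[of _ _ cis]) (simp add: field_simps)
        also have "\<dots> = cis (2 * pi * of_int m * x0 / h) * cis (2 * pi * of_int m * y / h)"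
          by (simp only: cis_mult[symmetric] cis_multiple_2pi[OF Ints_of_int]) simp
        finally show ?thesis
          by (simp add: e_def gabor_system_def c_def s_def algebra_simps)
      qed
      have conte: "continuous_on UNIV (\<lambda>x. cnj (e x))"
        unfolding e_def gabor_system_def using \<open>h > 0\<close>
        by (auto intro!: continuous_intros continuous_on_compose2[OF cont])
      have bint: "integrable lborel (\<lambda>x. b j x *\<^sub>R cnj (e x))" for j
        unfolding b_def by (intro borel_integrable_compact) (auto intro: continuous_on_subset[OF conte])
      have gint: "integrable lborel (\<lambda>y. indicator {0..\<delta>} y *\<^sub>R (cnj (cis (2 * pi * of_int m * y / h)) * cnj (g (s j k + y))))" for j
        using \<open>h > 0\<close> by (intro borel_integrable_compact continuous_intros continuous_on_compose2[OF cont]) auto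
      have "L2_inner f (gabor_system g \<alpha> (1 / h) (m, k)) = (LINT x|lborel. (\<Sum>j\<in>J. d j * (b j x *\<^sub>R cnj (e x))))"
        by (simp add: L2_inner_def e_def f_def sum_distrib_right mult_ac)
      also have "\<dots> = (\<Sum>j\<in>J. d j * (LINT x|lborel. b j x *\<^sub>R cnj (e x)))"
        using bint by (subst Bochner_Integration.integral_sum) (auto simp del: mult_scaleR_right)
      also have "\<dots> = (\<Sum>j\<in>J. d j * (c * (LINT y|lborel. indicator {0..\<delta>} y *\<^sub>R (cnj (cis (2 * pi * of_int m * y / h)) * cnj (g (s j k + y))))))"
      proof (intro sum.cong refl arg_cong2[of _ _ _ _ times])
        fix j
        have "(LINT x|lborel. b j x *\<^sub>R cnj (e x)) = (LINT y|lborel. b j (x0 + of_int j * h + y) *\<^sub>R cnj (e (x0 + of_int j * h + y)))"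
          using lborel_integral_real_affine[of 1 "\<lambda>x. b j x *\<^sub>R cnj (e x)" "x0 + of_int j * h"] by simp
        also have "\<dots> = (LINT y|lborel. c * (indicator {0..\<delta>} y *\<^sub>R (cnj (cis (2 * pi * of_int m * y / h)) * cnj (g (s j k + y)))))"
          by (intro Bochner_Integration.integral_cong refl) (simp add: e_shift b_def indicator_def)
        finally show "(LINT x|lborel. b j x *\<^sub>R cnj (e x)) = c * (LINT y|lborel. indicator {0..\<delta>} y *\<^sub>R (cnj (cis (2 * pi * of_int m * y / h)) * cnj (g (s j k + y))))"
          by (simp only: integral_mult_right_zero)
      qed
      also have "\<dots> = c * (LINT y|lborel. (\<Sum>j\<in>J. d j * (indicator {0..\<delta>} y *\<^sub>R (cnj (cis (2 * pi * of_int m * y / h)) * cnj (g (s j k + y))))))"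
        using gint by (subst Bochner_Integration.integral_sum) (auto simp: sum_distrib_left mult.left_commute simp del: mult_scaleR_right)
      also have "(\<lambda>y. \<Sum>j\<in>J. d j * (indicator {0..\<delta>} y *\<^sub>R (cnj (cis (2 * pi * of_int m * y / h)) * cnj (g (s j k + y)))))
          = (\<lambda>y. p k y * cnj (\<phi> m y))"
        using \<delta> by (auto simp: fun_eq_iff p_def \<phi>_def P_def indicator_def sum_distrib_right mult_ac)
      finally show ?thesis by (simp add: norm_mult c_def)
    qed
    have p2int: "integrable lborel (\<lambda>y. (cmod (p k y))\<^sup>2)" for k
    proof -
      have "(\<lambda>y. (cmod (p k y))\<^sup>2) = (\<lambda>y. indicator {0..\<delta>} y *\<^sub>R (cmod (P k y))\<^sup>2)"
        by (auto simp: p_def indicator_def fun_eq_iff)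
      then show ?thesis
        by (simp only:) (intro borel_integrable_compact continuous_intros contP; use \<open>h > 0\<close> in auto)
    qed
    have bessel: "(\<Sum>m\<in>I. (cmod (L2_inner f (gabor_system g \<alpha> (1 / h) (m, k))))\<^sup>2) \<le> h * (LINT y|lborel. (cmod (p k y))\<^sup>2)"
      if "finite I" for I k
      unfolding inner
    proof (rule bessel_inequality[OF that \<open>h > 0\<close>])
      show "integrable lborel (\<lambda>x. p k x * cnj (p k x))"
        unfolding complex_norm_square[symmetric] by (rule integrable_of_real[OF p2int])
      show "integrable lborel (\<lambda>x. p k x * cnj (\<phi> i x))" for i
      proof -
        have "(\<lambda>x. p k x * cnj (\<phi> i x)) = (\<lambda>x. indicator {0..\<delta>} x *\<^sub>R (P k x * cnj (cis (2 * pi * of_int i * x / h))))"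
          using \<delta> by (auto simp: p_def \<phi>_def indicator_def fun_eq_iff)
        then show ?thesis
          by (simp only:) (intro borel_integrable_compact continuous_intros contP; use \<open>h > 0\<close> in auto)
      qed
      have \<phi>\<phi>: "(\<lambda>x. \<phi> i x * cnj (\<phi> j x)) = (\<lambda>x. indicator {0..h} x *\<^sub>R cis (2 * pi * of_int (i - j) * x / h))" for i j
        by (auto simp: \<phi>_def fun_eq_iff indicator_def cis_cnj cis_mult right_diff_distrib left_diff_distrib diff_divide_distrib)
      show "integrable lborel (\<lambda>x. \<phi> i x * cnj (\<phi> j x))" for i j
        unfolding \<phi>\<phi> using \<open>h > 0\<close> by (intro borel_integrable_compact continuous_intros) auto
      show "(LINT x|lborel. \<phi> i x * cnj (\<phi> j x)) = (if i = j then of_real h else 0)" for i j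
        unfolding \<phi>\<phi> integral_exponential_over_period[OF \<open>h > 0\<close>] by simp
    qed
    \<comment> \<open>Only finite sums over modulations and translations occur, so integral and sum commute.\<close>
    have upper: "(\<Sum>i\<in>F. (cmod (L2_inner f (gabor_system g \<alpha> (1 / h) i)))\<^sup>2) \<le> h * (\<delta> * (E + \<epsilon>))"
      if "finite F" for F
    proof -
      have "(\<Sum>i\<in>F. (cmod (L2_inner f (gabor_system g \<alpha> (1 / h) i)))\<^sup>2)
          \<le> (\<Sum>i\<in>fst ` F \<times> snd ` F. (cmod (L2_inner f (gabor_system g \<alpha> (1 / h) i)))\<^sup>2)"
        using that by (intro sum_mono2) (auto simp: image_iff, force+)
      also have "\<dots> = (\<Sum>k\<in>snd ` F. \<Sum>m\<in>fst ` F. (cmod (L2_inner f (gabor_system g \<alpha> (1 / h) (m, k))))\<^sup>2)"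
        by (subst sum.swap) (simp add: sum.cartesian_product)
      also have "\<dots> \<le> (\<Sum>k\<in>snd ` F. h * (LINT y|lborel. (cmod (p k y))\<^sup>2))"
        using that by (intro sum_mono bessel) auto
      also have "\<dots> = h * (LINT y|lborel. (\<Sum>k\<in>snd ` F. (cmod (p k y))\<^sup>2))"
        using p2int by (subst Bochner_Integration.integral_sum) (auto simp: sum_distrib_left)
      also have "\<dots> \<le> h * (LINT y|lborel. (E + \<epsilon>) * indicator {0..\<delta>} y)"
      proof (intro mult_left_mono integral_mono)
        show "integrable lborel (\<lambda>y. \<Sum>k\<in>snd ` F. (cmod (p k y))\<^sup>2)" by (intro Bochner_Integration.integrable_sum p2int)
        show "integrable lborel (\<lambda>y. (E + \<epsilon>) * indicator {0..\<delta>} y)"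
          using \<delta> by (intro integrable_mult_right) simp
        show "(\<Sum>k\<in>snd ` F. (cmod (p k y))\<^sup>2) \<le> (E + \<epsilon>) * indicator {0..\<delta>} y" for y
        proof (cases "y \<in> {0..\<delta>}")
          case True
          then have y: "y \<in> {0..h}" "\<bar>y\<bar> < \<delta>0" using \<delta> by auto
          have "(\<Sum>k\<in>snd ` F. (cmod (p k y))\<^sup>2) = (\<Sum>k\<in>snd ` F. (cmod (P k y))\<^sup>2)"
            using True by (simp add: p_def)
          also have "\<dots> \<le> \<Phi> y" unfolding \<Phi>_def
            using that by (intro finite_sum_le_infsum sumP y) auto
          also have "\<dots> \<le> E + \<epsilon>" using \<delta>0[OF y] by simp
          finally show ?thesis using True by simp
        qed (simp add: p_def)
      qed (use \<open>h > 0\<close> in auto)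
      also have "(LINT y|lborel. (E + \<epsilon>) * indicator {0..\<delta>} y) = \<delta> * (E + \<epsilon>)"
        using \<delta> by simp
      finally show ?thesis .
    qed
    have "ennreal (A * (L2_norm f)\<^sup>2) \<le> ennreal (h * (\<delta> * (E + \<epsilon>)))"
      using A[OF \<open>f \<in> L2\<close>]
    proof (rule order_trans)
      show "(\<Sum>\<^sub>\<infinity>i. ennreal ((cmod (L2_inner f (gabor_system g \<alpha> (1 / h) i)))\<^sup>2)) \<le> ennreal (h * (\<delta> * (E + \<epsilon>)))"
        using upper by (intro infsum_le_finite_sums) (auto intro!: nonneg_summable_on_complete ennreal_leI)
    qed
    moreover have "0 \<le> h * (\<delta> * (E + \<epsilon>))" using upper[of "{}"] by simp
    ultimately have "\<delta> * (A * (\<Sum>j\<in>J. (cmod (d j))\<^sup>2)) \<le> \<delta> * (h * (E + \<epsilon>))"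
      by (simp add: normf ennreal_le_iff mult.left_commute)
    then have "A * (\<Sum>j\<in>J. (cmod (d j))\<^sup>2) \<le> h * (E + \<epsilon>)"
      using \<delta> by (simp only: mult_le_cancel_left_pos)
    then show "A / h * (\<Sum>j\<in>J. (cmod (d j))\<^sup>2) \<le> E + \<epsilon>"
      using \<open>h > 0\<close> by (simp add: divide_le_eq mult.commute)
  qed
  then show ?thesis using \<open>A > 0\<close> \<open>h > 0\<close> by (intro that[of "A / h"]) auto
qed

section \<open>Bounded annihilating sequences\<close>

text \<open>
  A tent of half-width \<open>R\<close> has slope \<open>1 / R\<close>. For \<open>\<bar>v\<bar> \<le> 2 * R\<close> this is at most a multiple of
  \<open>1 / (1 + \<bar>v\<bar>)\<close>; for larger \<open>\<bar>v\<bar>\<close> the tent vanishes at \<open>v\<close>, and \<open>\<bar>u - v\<bar>\<close> is comparable with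
  \<open>\<bar>v\<bar>\<close> whenever it does not vanish at \<open>u\<close>. The bound is square summable along a lattice in
  \<open>v\<close>, uniformly in \<open>R\<close>.
\<close>

lemma tent_difference_bound:
  fixes R u v :: real
  assumes "R \<ge> 1"
  shows "\<bar>max 0 (1 - \<bar>u\<bar> / R) - max 0 (1 - \<bar>v\<bar> / R)\<bar> \<le> 3 / (1 + \<bar>v\<bar>) * \<bar>u - v\<bar>"
    (is "\<bar>?W u - ?W v\<bar> \<le> _")
proof (cases "\<bar>v\<bar> \<le> 2 * R")
  case True
  have "\<bar>?W u - ?W v\<bar> \<le> \<bar>(1 - \<bar>u\<bar> / R) - (1 - \<bar>v\<bar> / R)\<bar>" by linarith
  also have "\<dots> = \<bar>\<bar>v\<bar> - \<bar>u\<bar>\<bar> / R"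
    using assms by (simp add: diff_divide_distrib[symmetric])
  also have "\<dots> \<le> \<bar>u - v\<bar> / R" using assms by (intro divide_right_mono) auto
  also have "\<dots> = 1 / R * \<bar>u - v\<bar>" by simp
  also have "1 / R \<le> 3 / (1 + \<bar>v\<bar>)" using True assms by (simp add: field_simps)
  then have "1 / R * \<bar>u - v\<bar> \<le> 3 / (1 + \<bar>v\<bar>) * \<bar>u - v\<bar>" by (rule mult_right_mono) simp
  finally show ?thesis .
next
  case False
  have Wv: "?W v = 0" using False assms by (simp add: field_simps max_def)
  show ?thesis
  proof (cases "\<bar>u\<bar> \<le> R")
    case True
    have "?W u \<le> 1" "?W u \<ge> 0" using assms by auto
    moreover have "\<bar>v\<bar> - R \<le> \<bar>u - v\<bar>" using True by linarith
    then have "3 * \<bar>v\<bar> - 3 * R \<le> 3 * \<bar>u - v\<bar>" by simp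
    then have "1 + \<bar>v\<bar> \<le> 3 * \<bar>u - v\<bar>" using False assms by linarith
    then have "1 \<le> 3 / (1 + \<bar>v\<bar>) * \<bar>u - v\<bar>" by (simp add: field_simps)
    ultimately show ?thesis unfolding Wv by linarith
  next
    case False
    then have "?W u = 0" using assms by (simp add: field_simps max_def)
    then show ?thesis unfolding Wv by simp
  qed
qed

text \<open>
  The lower bound on samples applies to finitely supported sequences, so \<open>c\<close> is multiplied by a
  tent \<open>W\<close> of half-width \<open>R\<close>. On the sample at the translate by \<open>v = \<alpha> * k\<close>, \<open>W\<close> may be replaced
  by \<open>W - W v\<close> by the annihilation hypothesis; the factor \<open>\<bar>u - v\<bar>\<close> gained from the tent is
  absorbed by the decay of the window, and the sample is \<open>O(1 / (1 + \<bar>v\<bar>))\<close>. Hence the sum of the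
  squared samples stays bounded as \<open>R \<rightarrow> \<infinity>\<close>, whereas the squared norm of the truncated sequence
  tends to infinity.
\<close>

lemma gabor_not_frame_if_samples_annihilated:
  fixes g :: "real \<Rightarrow> complex" and c :: "int \<Rightarrow> complex" and \<alpha> h x0 K :: real
  assumes "\<alpha> > 0" "h > 0"
    and cont: "continuous_on UNIV g"
    and decay: "\<And>x. (1 + \<bar>x\<bar>) * cmod (g x) \<le> K / (1 + x\<^sup>2)"
    and c_le: "\<And>j. cmod (c j) \<le> 1"
    and c_inf: "infinite {j. cmod (c j) = 1}"
    and zero: "\<And>k::int. (\<Sum>\<^sub>\<infinity>j. c j * cnj (g (x0 + of_int j * h - \<alpha> * of_int k))) = 0"
  shows "\<not> is_frame (gabor_system g \<alpha> (1 / h))"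
proof
  assume frame: "is_frame (gabor_system g \<alpha> (1 / h))"
  have decay0: "cmod (g x) \<le> K / (1 + x\<^sup>2)" and decay1: "\<bar>x\<bar> * cmod (g x) \<le> K / (1 + x\<^sup>2)" for x
    using decay[of x] by (auto simp: distrib_right intro: order_trans[rotated])
  have K: "K \<ge> 0" using order_trans[OF norm_ge_zero decay0[of 0]] by simp
  obtain A where "A > 0" and A: "\<And>J d E. finite J \<Longrightarrow>
      (\<And>L. finite L \<Longrightarrow> (\<Sum>k\<in>L. (cmod (\<Sum>j\<in>J. d j * cnj (g (x0 + of_int j * h - \<alpha> * of_int k))))\<^sup>2) \<le> E) \<Longrightarrow>
      A * (\<Sum>j\<in>J. (cmod (d j))\<^sup>2) \<le> E"
    by (rule gabor_frame_imp_lower_bound_on_samples[OF \<open>\<alpha> > 0\<close> \<open>h > 0\<close> cont decay0 frame]) blast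
  define s where "s j k = x0 + of_int j * h - \<alpha> * of_int k" for j k :: int
  have s_eq: "s j k = (x0 - \<alpha> * of_int k) + of_int j * h" for j k by (simp add: s_def)
  obtain C where C: "\<And>x (J::int set). finite J \<Longrightarrow> (\<Sum>j\<in>J. 1 / (1 + (x + of_int j * h)\<^sup>2)) \<le> C"
    using sum_shifted_inverse_square_bounded[OF \<open>h > 0\<close>] by blast
  obtain C' where C': "\<And>x (L::int set). finite L \<Longrightarrow> (\<Sum>k\<in>L. 1 / (1 + (x + of_int k * \<alpha>)\<^sup>2)) \<le> C'"
    using sum_shifted_inverse_square_bounded[OF \<open>\<alpha> > 0\<close>] by blast
  define E where "E = (3 * (K * C))\<^sup>2 * C'"
  have summ: "(\<lambda>j. K * (1 / (1 + (s j k)\<^sup>2))) summable_on UNIV" for k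
    unfolding s_eq by (intro summable_on_cmult_right summable_on_shifted_inverse_square \<open>h > 0\<close>)
  have bound: "A * (of_nat n / 4) \<le> E" for n
  proof -
    obtain J0 where J0: "finite J0" "card J0 = n" "J0 \<subseteq> {j. cmod (c j) = 1}"
      using infinite_arbitrarily_large[OF c_inf] by blast
    \<comment> \<open>So large that the tent is at least \<open>1/2\<close> at the positions indexed by \<open>J0\<close>.\<close>
    define R where "R = max 1 (2 * (\<Sum>j\<in>J0. \<bar>s j 0\<bar>))"
    define W :: "real \<Rightarrow> real" where "W x = max 0 (1 - \<bar>x\<bar> / R)" for x
    have R: "R \<ge> 1" by (simp add: R_def)
    have W01: "0 \<le> W x" "W x \<le> 1" for x using R by (auto simp: W_def)
    have Wdiff: "\<bar>W u - W v\<bar> \<le> 3 / (1 + \<bar>v\<bar>) * \<bar>u - v\<bar>" for u v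
      unfolding W_def by (rule tent_difference_bound[OF R])
    define J where "J = {j. \<bar>s j 0\<bar> \<le> R}"
    have "finite J"
    proof (rule finite_subset)
      define B where "B = \<lceil>(R + \<bar>x0\<bar>) / h\<rceil>"
      show "J \<subseteq> {- B..B}"
      proof
        fix j assume "j \<in> J"
        then have "\<bar>x0 + of_int j * h\<bar> \<le> R" by (simp add: J_def s_def)
        then have "\<bar>of_int j * h\<bar> \<le> R + \<bar>x0\<bar>" by linarith
        then have "\<bar>of_int j\<bar> \<le> (R + \<bar>x0\<bar>) / h"
          using \<open>h > 0\<close> by (simp add: abs_mult le_divide_eq)
        then have "of_int \<bar>j\<bar> \<le> (of_int B :: real)" unfolding B_def by linarith
        then show "j \<in> {- B..B}" by (simp only: of_int_le_iff atLeastAtMost_iff) linarith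
      qed
    qed simp
    have W_out: "W (s j 0) = 0" if "j \<notin> J" for j
      using that R by (auto simp: J_def W_def field_simps max_def)
    define d where "d j = c j * W (s j 0)" for j
    have sample: "cmod (\<Sum>j\<in>J. d j * cnj (g (s j k))) \<le> 3 / (1 + \<bar>\<alpha> * of_int k\<bar>) * (K * C)" for k
    proof -
      define v where "v = \<alpha> * of_int k"
      define a where "a j = c j * cnj (g (s j k))" for j
      have a_le: "cmod (a j) \<le> cmod (g (s j k))" for j
        using mult_right_mono[OF c_le, of "cmod (g (s j k))"] by (simp add: a_def norm_mult)
      have a_sum: "a summable_on UNIV"
      proof (rule abs_summable_summable, rule Infinite_Sum.abs_summable_on_comparison_test'[OF summ])
        show "cmod (a j) \<le> K * (1 / (1 + (s j k)\<^sup>2))" for j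
          using order_trans[OF a_le decay0] by simp
      qed
      have "((\<lambda>j. W (s j 0) * a j) has_sum (\<Sum>j\<in>J. W (s j 0) * a j)) UNIV"
        by (rule has_sum_finite_neutralI[OF \<open>finite J\<close>]) (auto simp: W_out)
      moreover have "((\<lambda>j. of_real (- W v) * a j) has_sum (of_real (- W v) * 0)) UNIV"
        using has_sum_infsum[OF a_sum] zero[of k]
        by (intro has_sum_cmult_right) (simp add: a_def[abs_def] s_def)
      ultimately have diff: "((\<lambda>j. W (s j 0) * a j + of_real (- W v) * a j) has_sum
          ((\<Sum>j\<in>J. W (s j 0) * a j) + of_real (- W v) * 0)) UNIV"
        by (rule has_sum_add)
      have term_le: "cmod (W (s j 0) * a j + of_real (- W v) * a j) \<le> 3 / (1 + \<bar>v\<bar>) * (K * (1 / (1 + (s j k)\<^sup>2)))" for j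
      proof -
        have "cmod (W (s j 0) * a j + of_real (- W v) * a j) = \<bar>W (s j 0) - W v\<bar> * cmod (a j)"
          by (simp add: left_diff_distrib[symmetric] norm_mult flip: of_real_diff)
        also have "\<dots> \<le> 3 / (1 + \<bar>v\<bar>) * \<bar>s j 0 - v\<bar> * cmod (g (s j k))"
          by (intro mult_mono Wdiff a_le) auto
        also have "s j 0 - v = s j k" by (simp add: s_def v_def)
        also have "3 / (1 + \<bar>v\<bar>) * \<bar>s j k\<bar> * cmod (g (s j k)) = 3 / (1 + \<bar>v\<bar>) * (\<bar>s j k\<bar> * cmod (g (s j k)))"
          by simp
        also have "\<dots> \<le> 3 / (1 + \<bar>v\<bar>) * (K / (1 + (s j k)\<^sup>2))"
          by (intro mult_left_mono decay1) auto
        finally show ?thesis by simp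
      qed
      have "cmod ((\<Sum>j\<in>J. W (s j 0) * a j) + of_real (- W v) * 0) \<le> (\<Sum>\<^sub>\<infinity>j. 3 / (1 + \<bar>v\<bar>) * (K * (1 / (1 + (s j k)\<^sup>2))))"
        by (rule norm_infsum_le[OF diff _ term_le]) (intro has_sum_infsum summable_on_cmult_right summ)
      also have "\<dots> \<le> 3 / (1 + \<bar>v\<bar>) * (K * C)"
      proof (rule infsum_le_finite_sums)
        show "(\<lambda>j. 3 / (1 + \<bar>v\<bar>) * (K * (1 / (1 + (s j k)\<^sup>2)))) summable_on UNIV"
          by (intro summable_on_cmult_right summ)
        fix F :: "int set" assume "finite F"
        have "(\<Sum>j\<in>F. 3 / (1 + \<bar>v\<bar>) * (K * (1 / (1 + (s j k)\<^sup>2)))) = 3 / (1 + \<bar>v\<bar>) * (K * (\<Sum>j\<in>F. 1 / (1 + (s j k)\<^sup>2)))"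
          by (simp only: sum_distrib_left)
        also have "\<dots> \<le> 3 / (1 + \<bar>v\<bar>) * (K * C)"
          unfolding s_eq by (intro mult_left_mono C \<open>finite F\<close> K) auto
        finally show "(\<Sum>j\<in>F. 3 / (1 + \<bar>v\<bar>) * (K * (1 / (1 + (s j k)\<^sup>2)))) \<le> 3 / (1 + \<bar>v\<bar>) * (K * C)" .
      qed
      finally show ?thesis by (simp add: d_def a_def v_def mult_ac)
    qed
    have "A * (\<Sum>j\<in>J. (cmod (d j))\<^sup>2) \<le> E"
    proof (rule A[OF \<open>finite J\<close>])
      fix L :: "int set" assume "finite L"
      have "(\<Sum>k\<in>L. (cmod (\<Sum>j\<in>J. d j * cnj (g (s j k))))\<^sup>2) \<le> (\<Sum>k\<in>L. (3 * (K * C))\<^sup>2 * (1 / (1 + (0 + of_int k * \<alpha>)\<^sup>2)))"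
      proof (rule sum_mono)
        fix k :: int
        define v where "v = \<alpha> * of_int k"
        have "(cmod (\<Sum>j\<in>J. d j * cnj (g (s j k))))\<^sup>2 \<le> (3 / (1 + \<bar>v\<bar>) * (K * C))\<^sup>2"
          unfolding v_def by (intro power_mono sample) auto
        also have "\<dots> = (3 * (K * C))\<^sup>2 * (1 / (1 + \<bar>v\<bar>)\<^sup>2)" by (simp add: power_divide)
        also have "\<dots> \<le> (3 * (K * C))\<^sup>2 * (1 / (1 + v\<^sup>2))"
        proof (intro mult_left_mono divide_left_mono)
          show "1 + v\<^sup>2 \<le> (1 + \<bar>v\<bar>)\<^sup>2" by (simp add: power2_sum)
        qed (auto intro!: mult_pos_pos add_pos_nonneg)
        finally show "(cmod (\<Sum>j\<in>J. d j * cnj (g (s j k))))\<^sup>2 \<le> (3 * (K * C))\<^sup>2 * (1 / (1 + (0 + of_int k * \<alpha>)\<^sup>2))"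
          by (simp add: v_def mult.commute)
      qed
      also have "\<dots> = (3 * (K * C))\<^sup>2 * (\<Sum>k\<in>L. 1 / (1 + (0 + of_int k * \<alpha>)\<^sup>2))" by (simp only: sum_distrib_left)
      also have "\<dots> \<le> E" unfolding E_def by (intro mult_left_mono C' \<open>finite L\<close>) auto
      finally show "(\<Sum>k\<in>L. (cmod (\<Sum>j\<in>J. d j * cnj (g (x0 + of_int j * h - \<alpha> * of_int k))))\<^sup>2) \<le> E"
        by (simp add: s_def)
    qed
    moreover have "of_nat n / 4 \<le> (\<Sum>j\<in>J. (cmod (d j))\<^sup>2)"
    proof -
      have half: "\<bar>s j 0\<bar> \<le> R / 2" if "j \<in> J0" for j
        using member_le_sum[OF that, of "\<lambda>j. \<bar>s j 0\<bar>"] \<open>finite J0\<close> by (simp add: R_def max_def)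
      have "of_nat n / 4 = (\<Sum>j\<in>J0. (1/2)\<^sup>2 :: real)" using J0 by (simp add: power2_eq_square)
      also have "\<dots> \<le> (\<Sum>j\<in>J0. (cmod (d j))\<^sup>2)"
      proof (intro sum_mono power_mono)
        fix j assume j: "j \<in> J0"
        have "1 / 2 \<le> W (s j 0)" using half[OF j] R by (simp add: W_def field_simps le_max_iff_disj)
        moreover have "cmod (c j) = 1" using j J0 by auto
        ultimately show "1 / 2 \<le> cmod (d j)" using W01 by (simp add: d_def norm_mult)
      qed simp
      also have "\<dots> \<le> (\<Sum>j\<in>J. (cmod (d j))\<^sup>2)"
      proof (rule sum_mono2[OF \<open>finite J\<close>])
        show "J0 \<subseteq> J" using half R by (force simp: J_def)
      qed simp
      finally show ?thesis .
    qed
    ultimately show ?thesis using \<open>A > 0\<close> by (meson mult_left_mono less_imp_le order_trans)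
  qed
  obtain n :: nat where "of_nat n > 4 * E / A" using reals_Archimedean2 by blast
  with bound[of n] \<open>A > 0\<close> show False by (simp add: field_simps)
qed

section \<open>Periodizations and their symmetries\<close>

definition periodization :: "(real \<Rightarrow> real) \<Rightarrow> real \<Rightarrow> real \<Rightarrow> real" where
  "periodization r h x = (\<Sum>\<^sub>\<infinity>j::int. r (x + of_int j * h))"

definition alternating_periodization :: "(real \<Rightarrow> real) \<Rightarrow> real \<Rightarrow> real \<Rightarrow> real" where
  "alternating_periodization r h x = (\<Sum>\<^sub>\<infinity>j::int. (if even j then 1 else - 1) * r (x + of_int j * h))"

lemma periodization_shift: "periodization r h (x + of_int n * h) = periodization r h x"
  unfolding periodization_def
  by (rule infsum_reindex_bij_witness[of _ "\<lambda>j. j - n" "\<lambda>j. j + n"]) (auto simp: algebra_simps)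

lemma periodization_even:
  assumes "\<And>x. r (- x) = r x"
  shows "periodization r h (- x) = periodization r h x"
  unfolding periodization_def
proof (rule infsum_reindex_bij_witness[of _ uminus uminus])
  show "r (x + of_int (- j) * h) = r (- x + of_int j * h)" for j
    using assms[of "x + of_int (- j) * h"] by simp
qed auto

lemma alternating_periodization_shift:
  "alternating_periodization r h (x + of_int n * h) = (if even n then 1 else - 1) * alternating_periodization r h x"
proof -
  have "alternating_periodization r h (x + of_int n * h)
      = (\<Sum>\<^sub>\<infinity>j::int. (if even n then 1 else - 1) * ((if even j then 1 else - 1) * r (x + of_int j * h)))"
    unfolding alternating_periodization_def
    by (rule infsum_reindex_bij_witness[of _ "\<lambda>j. j - n" "\<lambda>j. j + n"]) (auto simp: algebra_simps)
  then show ?thesis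
    by (simp add: alternating_periodization_def infsum_uminus)
qed

lemma alternating_periodization_even:
  assumes "\<And>x. r (- x) = r x"
  shows "alternating_periodization r h (- x) = alternating_periodization r h x"
  unfolding alternating_periodization_def
proof (rule infsum_reindex_bij_witness[of _ uminus uminus])
  show "(if even (- j) then 1 else - 1) * r (x + of_int (- j) * h) = (if even j then 1 else - 1) * r (- x + of_int j * h)" for j
    using assms[of "x + of_int (- j) * h"] by simp
qed auto

text \<open>
  With period \<open>h = N * t\<close> the alternating sum is even and changes sign under translation by \<open>h\<close>.
  Up to translation, the odd multiples of \<open>t\<close> are \<open>\<plusminus>t\<close> and, for \<open>N = 6\<close>, also \<open>3 * t = h / 2\<close>, where
  the two symmetries together force the value \<open>0\<close>.
\<close>

lemma alternating_periodization_odd_multiples: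
  fixes t :: real and n :: int and N :: nat
  assumes even_r: "\<And>x. r (- x) = r x"
    and N: "N = 4 \<or> N = 6" and "odd n"
    and zero: "alternating_periodization r (real N * t) t = 0"
  shows "alternating_periodization r (real N * t) (of_int n * t) = 0"
proof -
  let ?Z = "alternating_periodization r (real N * t)"
  note [simp] = alternating_periodization_even[of r, OF even_r]
  have shift: "?Z (of_int n * t) = 0" if "n = m + int N * i" "?Z (of_int m * t) = 0" for m i :: int
  proof -
    have "of_int n * t = of_int m * t + of_int i * (real N * t)" by (simp add: that algebra_simps)
    then show ?thesis using that by (simp only: alternating_periodization_shift mult_zero_right)
  qed
  have minus1: "?Z (of_int (- 1) * t) = 0" using zero by simp
  from N show ?thesis
  proof
    assume N: "N = 4"
    have "n = 1 + int N * (n div 4) \<or> n = - 1 + int N * (n div 4 + 1)"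
      using \<open>odd n\<close> unfolding N by presburger
    then show ?thesis using zero minus1 by (elim disjE shift) auto
  next
    assume N: "N = 6"
    have "of_int 3 * t = of_int (- 3) * t + of_int 1 * (real N * t)" using N by simp
    then have "?Z (of_int 3 * t) = ?Z (of_int (- 3) * t + of_int 1 * (real N * t))" by (rule arg_cong)
    also have "\<dots> = - ?Z (- (of_int 3 * t))" by (subst alternating_periodization_shift) simp
    finally have three: "?Z (of_int 3 * t) = 0" by simp
    have "n = 1 + int N * (n div 6) \<or> n = - 1 + int N * (n div 6 + 1) \<or> n = 3 + int N * (n div 6)"
      using \<open>odd n\<close> unfolding N by presburger
    then show ?thesis using zero minus1 three by (elim disjE shift) auto
  qed
qed

section \<open>The window\<close>

definition window :: "real \<Rightarrow> real" where
  "window x = (x\<^sup>2 - 1) / ((x\<^sup>2 + 1) * (x\<^sup>2 + 4) * (x\<^sup>2 + 9))"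

lemma window_even: "window (- x) = window x"
  by (simp add: window_def)

lemma window_continuous: "continuous_on A window"
proof -
  have "x\<^sup>2 + 1 \<noteq> 0" "x\<^sup>2 + 4 \<noteq> 0" "x\<^sup>2 + 9 \<noteq> 0" for x :: real
    by (smt (verit) zero_le_power2)+
  then show ?thesis unfolding window_def[abs_def] by (intro continuous_intros) auto
qed

text \<open>
  The extra factor \<open>1 + \<bar>x\<bar>\<close> pays for the increment of the tents.
\<close>

lemma window_decay: "(1 + \<bar>x\<bar>) * \<bar>window x\<bar> \<le> 1 / (1 + x\<^sup>2)"
proof -
  define t where "t = x\<^sup>2"
  have t: "t \<ge> 0" by (simp add: t_def)
  have "\<bar>x\<bar> \<le> t + 1"
    using zero_le_power2[of "\<bar>x\<bar> - 1"] t by (simp add: t_def power2_eq_square algebra_simps)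
  then have x: "(1 + \<bar>x\<bar>) / (t + 4) \<le> 1" using t by simp
  have w: "\<bar>window x\<bar> = \<bar>t - 1\<bar> / (t + 1) * (1 / (t + 4)) * (1 / (t + 9))"
    using t by (simp add: window_def t_def[symmetric] abs_mult)
  have "\<bar>t - 1\<bar> / (t + 1) \<le> 1" using t by simp
  then have "\<bar>t - 1\<bar> / (t + 1) * ((1 + \<bar>x\<bar>) / (t + 4)) * (1 / (t + 9)) \<le> 1 * 1 * (1 / (1 + t))"
    using t x by (intro mult_mono divide_left_mono) auto
  then show ?thesis unfolding w by (simp add: t_def mult_ac)
qed

lemma window_decay': "\<bar>window x\<bar> \<le> 1 / (1 + x\<^sup>2)"
proof -
  have "1 * \<bar>window x\<bar> \<le> (1 + \<bar>x\<bar>) * \<bar>window x\<bar>" by (intro mult_right_mono) auto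
  with window_decay[of x] show ?thesis by simp
qed

lemma window_nonneg: "1 \<le> x \<Longrightarrow> 0 \<le> window x"
  by (simp add: window_def one_le_power)

text \<open>
  In \<open>t = x\<^sup>2\<close> the window is \<open>(t - 1) / ((t + 1) * (t + 4))\<close> times the decreasing \<open>1 / (t + 9)\<close>; the
  first factor decreases as long as \<open>(t - 1) * (s - 1) > 10\<close> for the points \<open>t < s\<close> compared.
\<close>

lemma window_strict_antimono:
  assumes "3 \<le> x" "x < y"
  shows "window y < window x"
proof -
  define t s where "t = x\<^sup>2" and "s = y\<^sup>2"
  have "3\<^sup>2 \<le> t" unfolding t_def using assms by (intro power_mono) auto
  then have t: "t \<ge> 9" by simp
  have ts: "t < s" unfolding t_def s_def using assms by (intro power_strict_mono) auto
  have "64 \<le> (t - 1) * (s - 1)" using mult_mono[of 8 "t - 1" 8 "s - 1"] t ts by simp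
  then have "0 < (s - t) * ((t - 1) * (s - 1) - 10)" using ts by (intro mult_pos_pos) auto
  also have "\<dots> = (t - 1) * ((s + 1) * (s + 4)) - (s - 1) * ((t + 1) * (t + 4))"
    by (simp add: algebra_simps)
  finally have "(s - 1) / ((s + 1) * (s + 4)) < (t - 1) / ((t + 1) * (t + 4))"
    using t ts by (simp add: divide_simps mult_ac)
  moreover have "1 / (s + 9) < 1 / (t + 9)" using t ts by (simp add: divide_simps)
  ultimately have "(s - 1) / ((s + 1) * (s + 4)) * (1 / (s + 9)) < (t - 1) / ((t + 1) * (t + 4)) * (1 / (t + 9))"
    using t ts by (intro mult_strict_mono) auto
  then show ?thesis by (simp add: window_def t_def s_def)
qed

text \<open>
  Pairing \<open>j\<close> with \<open>- j\<close>, the sum at \<open>t\<close> is \<open>window t - a 0 + a 1 - a 2 + \<dots>\<close>, where for \<open>t \<ge> 1\<close> the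
  \<open>a n\<close> decrease to \<open>0\<close> since they involve the window only on \<open>{3..}\<close>. At \<open>t = 1\<close> the window has its
  zero, and the sum is negative; at \<open>t = 3\<close> the first term dominates, and the sum is positive.
\<close>

lemma exists_alternating_periodization_zero:
  fixes N :: nat
  assumes "N \<ge> 4"
  obtains t where "t > 0" "alternating_periodization window (real N * t) t = 0"
proof -
  have N: "real N \<ge> 4" using assms by simp
  define f where "f t j = (if even j then 1 else - 1) * window (t + of_int j * (real N * t))" for t and j :: int
  define S where "S t = (\<Sum>\<^sub>\<infinity>j. f t j)" for t
  define M where "M j = 1 / (1 + (1 + of_int j * real N)\<^sup>2)" for j :: int
  have M: "M summable_on UNIV"
    unfolding M_def by (rule summable_on_shifted_inverse_square) (use N in auto)
  have fM: "norm (f t j) \<le> M j" if "t \<ge> 1" for t j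
  proof -
    define u where "u = 1 + of_int j * real N"
    have "t + of_int j * (real N * t) = t * u" by (simp add: u_def algebra_simps)
    then have "norm (f t j) = \<bar>window (t * u)\<bar>" by (simp add: f_def)
    also have "\<dots> \<le> 1 / (1 + (t * u)\<^sup>2)" by (rule window_decay')
    also have "\<dots> \<le> 1 / (1 + u\<^sup>2)"
    proof (intro divide_left_mono mult_pos_pos add_pos_nonneg add_left_mono)
      have "1 * u\<^sup>2 \<le> t\<^sup>2 * u\<^sup>2" using that by (intro mult_right_mono) (auto simp: one_le_power)
      then show "u\<^sup>2 \<le> (t * u)\<^sup>2" by (simp add: power_mult_distrib)
    qed auto
    finally show ?thesis by (simp add: M_def u_def)
  qed
  have cont: "continuous_on {1..3} S"
    unfolding S_def
  proof (rule continuous_on_infsum_dominated[OF _ _ M])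
    show "continuous_on {1..3} (\<lambda>t. f t j)" for j
      unfolding f_def by (intro continuous_intros continuous_on_compose2[OF window_continuous[of UNIV]]) auto
  qed (use fM in auto)
  define a where "a t n = window (t * (of_nat (Suc n) * real N + 1)) + window (t * (of_nat (Suc n) * real N - 1))" for t and n :: nat
  have arg: "3 \<le> t * (of_nat (Suc n) * real N - 1)" if "t \<ge> 1" for t n
  proof -
    have "1 * 4 \<le> of_nat (Suc n) * real N" using N by (intro mult_mono) auto
    then have "1 * 3 \<le> t * (of_nat (Suc n) * real N - 1)" using that by (intro mult_mono) auto
    then show ?thesis by simp
  qed
  have arg': "t * (of_nat (Suc n) * real N - 1) \<le> t * (of_nat (Suc n) * real N + 1)" if "t \<ge> 1" for t n
    using that by (intro mult_left_mono) auto
  have a_nonneg: "0 \<le> a t n" if "t \<ge> 1" for t n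
    unfolding a_def using arg[OF that, of n] arg'[OF that, of n]
    by (intro add_nonneg_nonneg window_nonneg) linarith+
  have a_strict: "a t (Suc n) < a t n" if "t \<ge> 1" for t n
  proof -
    have "of_nat (Suc n) * real N < of_nat (Suc (Suc n)) * real N" using N by (intro mult_strict_right_mono) auto
    then have less: "t * (of_nat (Suc n) * real N + e) < t * (of_nat (Suc (Suc n)) * real N + e)" for e
      using that by (intro mult_strict_left_mono) auto
    show ?thesis
      unfolding a_def
      by (intro add_strict_mono window_strict_antimono less order_trans[OF arg arg'] that)
        (use arg[OF that] less[of "- 1"] in auto)
  qed
  have a_lim: "a t \<longlonglongrightarrow> 0" if "t \<ge> 1" for t
  proof -
    have *: "(\<lambda>n. window (t * (of_nat (Suc n) * real N + e))) \<longlonglongrightarrow> 0" if "e \<ge> - 1" for e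
    proof (rule Lim_null_comparison[OF _ LIMSEQ_inverse_real_of_nat], intro always_eventually allI)
      fix n
      define u where "u = t * (of_nat (Suc n) * real N + e)"
      have "real (Suc n) * 2 \<le> of_nat (Suc n) * real N" using N by (intro mult_left_mono) auto
      then have "1 * real (Suc n) \<le> u"
        unfolding u_def using that \<open>t \<ge> 1\<close> by (intro mult_mono) auto
      then have u: "real (Suc n) \<le> u" by simp
      have "u * 1 \<le> u * u" using u by (intro mult_left_mono) auto
      then have "u \<le> u\<^sup>2" by (simp add: power2_eq_square)
      then have "real (Suc n) \<le> 1 + u\<^sup>2" using u by linarith
      then have "1 / (1 + u\<^sup>2) \<le> 1 / real (Suc n)" by (intro divide_left_mono mult_pos_pos) auto
      then show "norm (window (t * (of_nat (Suc n) * real N + e))) \<le> inverse (real (Suc n))"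
        using window_decay'[of u] by (simp add: u_def inverse_eq_divide)
    qed
    show ?thesis
      using tendsto_add[OF *[of 1] *[of "- 1"]] by (simp add: a_def[abs_def])
  qed
  have S_eq: "S t = window t - (\<Sum>n. (- 1) ^ n * a t n)" if "t \<ge> 1" for t
  proof -
    have sumf: "f t summable_on UNIV"
      by (rule abs_summable_summable, rule Infinite_Sum.abs_summable_on_comparison_test'[OF M]) (rule fM[OF that])
    have "f t (int (Suc n)) + f t (- int (Suc n)) = - ((- 1) ^ n * a t n)" for n
    proof -
      have "t + of_int (int (Suc n)) * (real N * t) = t * (of_nat (Suc n) * real N + 1)"
        by (simp add: algebra_simps)
      moreover have "window (t + of_int (- int (Suc n)) * (real N * t)) = window (t * (of_nat (Suc n) * real N - 1))"
        by (subst window_even[symmetric]) (simp add: algebra_simps)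
      ultimately show ?thesis by (simp add: f_def a_def)
    qed
    then have "S t = f t 0 + (\<Sum>n. - ((- 1) ^ n * a t n))"
      unfolding S_def infsum_int_symmetric[OF sumf] by simp
    also have "(\<Sum>n. - ((- 1) ^ n * a t n)) = - (\<Sum>n. (- 1) ^ n * a t n)"
      by (rule suminf_minus) (rule summable_Leibniz'(1)[OF a_lim[OF that] a_nonneg[OF that] less_imp_le[OF a_strict[OF that]]])
    finally show ?thesis by (simp add: f_def)
  qed
  have leibniz: "a t 0 - a t 1 \<le> (\<Sum>n. (- 1) ^ n * a t n)" "(\<Sum>n. (- 1) ^ n * a t n) \<le> a t 0" if "t \<ge> 1" for t
    using summable_Leibniz'(2)[OF a_lim[OF that] a_nonneg[OF that] less_imp_le[OF a_strict[OF that]], of 1]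
      summable_Leibniz'(4)[OF a_lim[OF that] a_nonneg[OF that] less_imp_le[OF a_strict[OF that]], of 0]
    by (simp_all add: numeral_2_eq_2)
  have "S 1 \<le> 0"
    using S_eq[of 1] leibniz(1)[of 1] a_strict[of 1 0] by (simp add: window_def)
  moreover have "0 \<le> S 3"
  proof -
    have "window (3 * (of_nat (Suc 0) * real N + 1)) < window 9"
      using N by (intro window_strict_antimono) auto
    moreover have "window (3 * (of_nat (Suc 0) * real N - 1)) \<le> window 9"
      using window_strict_antimono[of 9 "3 * (of_nat (Suc 0) * real N - 1)"] N
      by (cases "N = 4") (auto simp: less_imp_le)
    ultimately have "a 3 0 \<le> 2 * window 9" unfolding a_def by simp
    also have "\<dots> \<le> window 3" by (simp add: window_def)
    finally show ?thesis using S_eq[of 3] leibniz(2)[of 3] by simp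
  qed
  ultimately obtain t where "1 \<le> t" "t \<le> 3" "S t = 0"
    using IVT'[of S 1 0 3] cont by auto
  then show thesis
    by (intro that[of t]) (auto simp: S_def f_def alternating_periodization_def)
qed

section \<open>Gabor systems of the window\<close>

lemma window_summable:
  fixes \<gamma> :: "int \<Rightarrow> real" and h x :: real
  assumes "h > 0" and "\<And>j. \<bar>\<gamma> j\<bar> \<le> 1"
  shows "(\<lambda>j::int. \<gamma> j * window (x + of_int j * h)) summable_on UNIV"
proof (rule abs_summable_summable, rule Infinite_Sum.abs_summable_on_comparison_test')
  show "(\<lambda>j::int. 1 / (1 + (x + of_int j * h)\<^sup>2)) summable_on UNIV"
    by (rule summable_on_shifted_inverse_square[OF \<open>h > 0\<close>])
  show "norm (\<gamma> j * window (x + of_int j * h)) \<le> 1 / (1 + (x + of_int j * h)\<^sup>2)" for j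
    using mult_mono[OF assms(2)[of j] window_decay'[of "x + of_int j * h"]] by (simp add: abs_mult)
qed

lemma infsum_residue_class:
  fixes f :: "int \<Rightarrow> 'a::{comm_monoid_add, t2_space}"
  assumes "0 \<le> r" "r < m"
  shows "infsum f {j. j mod m = r} = (\<Sum>\<^sub>\<infinity>i. f (m * i + r))"
proof (rule infsum_reindex_bij_witness[of _ "\<lambda>i. m * i + r" "\<lambda>j. j div m"])
  show "m * (j div m) + r = j" if "j \<in> {j. j mod m = r}" for j
    using that mult_div_mod_eq[of m j] by simp
  then show "f (m * (j div m) + r) = f j" if "j \<in> {j. j mod m = r}" for j
    using that by simp
  show "(m * i + r) div m = i" "m * i + r \<in> {j. j mod m = r}" for i
    using assms by simp_all
qed simp

lemma infsum_signed_residue_classes: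
  fixes \<gamma> :: "int \<Rightarrow> real"
  assumes "h > 0" and "0 \<le> p" "p < m" "0 \<le> q" "q < m" "p \<noteq> q"
    and \<gamma>: "\<And>j. \<gamma> j = (if j mod m = p then 1 else if j mod m = q then - 1 else 0)"
  shows "(\<Sum>\<^sub>\<infinity>j. \<gamma> j * window (x + of_int j * h))
    = periodization window (of_int m * h) (x + of_int p * h) - periodization window (of_int m * h) (x + of_int q * h)"
proof -
  let ?A = "\<lambda>r. {j. j mod m = r}"
  define f where "f j = \<gamma> j * window (x + of_int j * h)" for j
  have f: "f summable_on T" for T
    unfolding f_def by (rule summable_on_subset_banach[OF window_summable]) (auto simp: \<gamma> \<open>h > 0\<close>)
  have part: "(\<Sum>\<^sub>\<infinity>i. window (x + of_int (m * i + r) * h)) = periodization window (of_int m * h) (x + of_int r * h)" for r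
    unfolding periodization_def by (simp add: algebra_simps)
  have "infsum f UNIV = infsum f (?A p \<union> ?A q)"
    by (rule infsum_cong_neutral) (auto simp: f_def \<gamma>)
  also have "\<dots> = infsum f (?A p) + infsum f (?A q)"
    by (rule infsum_Un_disjoint) (use \<open>p \<noteq> q\<close> in \<open>auto intro: f\<close>)
  also have "infsum f (?A p) = (\<Sum>\<^sub>\<infinity>j\<in>?A p. window (x + of_int j * h))"
    by (rule infsum_cong) (auto simp: f_def \<gamma>)
  also have "\<dots> = periodization window (of_int m * h) (x + of_int p * h)"
    using assms by (simp only: infsum_residue_class part)
  also have "infsum f (?A q) = (\<Sum>\<^sub>\<infinity>j\<in>?A q. - window (x + of_int j * h))"
    by (rule infsum_cong) (use \<open>p \<noteq> q\<close> in \<open>auto simp: f_def \<gamma>\<close>)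
  also have "\<dots> = - periodization window (of_int m * h) (x + of_int q * h)"
    using assms by (simp only: infsum_residue_class infsum_uminus part)
  finally show ?thesis by (simp add: f_def)
qed

lemma window_gabor_not_frame:
  fixes \<gamma> :: "int \<Rightarrow> real" and \<alpha> h y :: real
  assumes "\<alpha> > 0" "h > 0"
    and \<gamma>: "\<And>j. \<bar>\<gamma> j\<bar> \<le> 1" "infinite {j. \<bar>\<gamma> j\<bar> = 1}"
    and zero: "\<And>k::int. (\<Sum>\<^sub>\<infinity>j. \<gamma> j * window (y - \<alpha> * of_int k + of_int j * h)) = 0"
  shows "\<not> is_frame (gabor_system (\<lambda>x. of_real (window x)) \<alpha> (1 / h))"
proof (rule gabor_not_frame_if_samples_annihilated[where c = "\<lambda>j. of_real (\<gamma> j)" and K = 1, OF \<open>\<alpha> > 0\<close> \<open>h > 0\<close>])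
  show "continuous_on UNIV (\<lambda>x. complex_of_real (window x))"
    by (intro continuous_intros window_continuous)
  show "(1 + \<bar>x\<bar>) * cmod (of_real (window x)) \<le> 1 / (1 + x\<^sup>2)" for x
    using window_decay[of x] by simp
  show "(\<Sum>\<^sub>\<infinity>j. of_real (\<gamma> j) * cnj (of_real (window (y + of_int j * h - \<alpha> * of_int k)))) = 0" for k
  proof -
    have "((\<lambda>j. \<gamma> j * window (y - \<alpha> * of_int k + of_int j * h)) has_sum
        (\<Sum>\<^sub>\<infinity>j. \<gamma> j * window (y - \<alpha> * of_int k + of_int j * h))) UNIV"
      by (intro has_sum_infsum window_summable \<open>h > 0\<close> \<gamma>)
    then have "((\<lambda>j. \<gamma> j * window (y - \<alpha> * of_int k + of_int j * h)) has_sum 0) UNIV"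
      by (simp only: zero)
    from infsumI[OF has_sum_of_real[OF this, where 'a = complex]] show ?thesis by (simp add: algebra_simps)
  qed
qed (use \<gamma> in auto)

lemma infinite_residue_class: "m > 0 \<Longrightarrow> infinite {j::int. j mod m = r mod m}"
proof
  assume "m > 0" "finite {j::int. j mod m = r mod m}"
  then have "finite (range (\<lambda>i. m * i + r))" by (elim finite_subset[rotated]) auto
  moreover have "inj (\<lambda>i. m * i + r)" using \<open>m > 0\<close> by (auto simp: inj_def)
  ultimately show False using finite_imageD infinite_UNIV_int by blast
qed

text \<open>
  The translations by even multiples of \<open>t\<close> sample the alternating periodization at odd multiples
  of \<open>t\<close> only.
\<close>

lemma window_gabor_not_frame_alternating:
  fixes t :: real and N l :: nat
  assumes "t > 0" "N = 4 \<or> N = 6" "l > 0"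
    and zero: "alternating_periodization window (real N * t) t = 0"
  shows "\<not> is_frame (gabor_system (\<lambda>x. of_real (window x)) (2 * real l * t) (1 / (real N * t)))"
proof (rule window_gabor_not_frame[where y = t and \<gamma> = "\<lambda>j. if even j then 1 else - 1"])
  show "(\<Sum>\<^sub>\<infinity>j. (if even j then 1 else - 1) * window (t - 2 * real l * t * of_int k + of_int j * (real N * t))) = 0" for k
  proof -
    have "t - 2 * real l * t * of_int k = of_int (1 - 2 * int l * k) * t" by (simp add: algebra_simps)
    moreover have "alternating_periodization window (real N * t) (of_int (1 - 2 * int l * k) * t) = 0"
      by (rule alternating_periodization_odd_multiples[of window, OF window_even \<open>N = 4 \<or> N = 6\<close> _ zero]) simp
    ultimately show ?thesis by (simp only: alternating_periodization_def)
  qed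
  have "{j::int. \<bar>if even j then 1 else - 1 :: real\<bar> = 1} = UNIV" by auto
  then show "infinite {j::int. \<bar>if even j then 1 else - 1 :: real\<bar> = 1}" by simp
qed (use assms in auto)

text \<open>
  The annihilating sequence \<open>0, 1, -1\<close>, repeated with period \<open>3\<close>, lives on the positions \<open>\<plusminus>4 * t\<close>
  modulo \<open>12 * t\<close>. Convolving it with the window gives a function with period \<open>12 * t\<close> that is odd
  about \<open>0\<close> and about \<open>6 * t\<close>, so it vanishes at the even multiples of \<open>3 * t\<close>. At the odd ones
  it is, by the evenness of the window, the alternating periodization with period \<open>6 * t\<close> at an odd
  multiple of \<open>t\<close>.
\<close>

lemma window_gabor_not_frame_three_quarters:
  fixes t :: real
  assumes "t > 0" and zero: "alternating_periodization window (6 * t) t = 0"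
  shows "\<not> is_frame (gabor_system (\<lambda>x. of_real (window x)) (3 * t) (1 / (4 * t)))"
proof -
  define \<gamma> :: "int \<Rightarrow> real" where "\<gamma> j = (if j mod 3 = 1 then 1 else if j mod 3 = 2 then - 1 else 0)" for j
  let ?P = "periodization window (12 * t)"
  have alt: "alternating_periodization window (6 * t) x = ?P x - ?P (x + 6 * t)" for x
  proof -
    have sign: "(if even j then 1 else - 1 :: real) = (if j mod 2 = 0 then 1 else if j mod 2 = 1 then - 1 else 0)" for j :: int
      by (auto simp: even_iff_mod_2_eq_zero)
    show ?thesis
      unfolding alternating_periodization_def
      using infsum_signed_residue_classes[of "6 * t" 0 2 1 "\<lambda>j. if even j then 1 else - 1" x, OF _ _ _ _ _ _ sign] \<open>t > 0\<close>
      by simp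
  qed
  have "(\<Sum>\<^sub>\<infinity>j. \<gamma> j * window (0 - 3 * t * of_int k + of_int j * (4 * t))) = 0" for k
  proof -
    define x where "x = of_int (4 - 3 * k) * t"
    have "(\<Sum>\<^sub>\<infinity>j. \<gamma> j * window (0 - 3 * t * of_int k + of_int j * (4 * t)))
        = ?P (0 - 3 * t * of_int k + 4 * t) - ?P (0 - 3 * t * of_int k + 8 * t)"
      using infsum_signed_residue_classes[of "4 * t" 1 3 2 \<gamma> "0 - 3 * t * of_int k"] \<open>t > 0\<close>
      by (simp add: \<gamma>_def)
    also have "0 - 3 * t * of_int k + 4 * t = x" by (simp add: x_def algebra_simps)
    also have "?P (0 - 3 * t * of_int k + 8 * t) = ?P (- (0 - 3 * t * of_int k + 8 * t))"
      by (rule periodization_even[of window, OF window_even, symmetric])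
    finally have sum_eq: "(\<Sum>\<^sub>\<infinity>j. \<gamma> j * window (0 - 3 * t * of_int k + of_int j * (4 * t)))
        = ?P x - ?P (- (0 - 3 * t * of_int k + 8 * t))" .
    show ?thesis
    proof (cases "even k")
      case True
      then obtain i where "k = 2 * i" by blast
      then have "- (0 - 3 * t * of_int k + 8 * t) = x + of_int (i - 1) * (12 * t)"
        by (simp add: x_def algebra_simps)
      then show ?thesis by (simp only: sum_eq periodization_shift)
    next
      case False
      then obtain i where "k = 2 * i + 1" by (rule oddE)
      then have "- (0 - 3 * t * of_int k + 8 * t) = x + 6 * t + of_int (i - 1) * (12 * t)"
        by (simp add: x_def algebra_simps)
      then have "?P x - ?P (- (0 - 3 * t * of_int k + 8 * t)) = alternating_periodization window (6 * t) x"
        by (simp only: alt periodization_shift)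
      also have "\<dots> = 0"
        using alternating_periodization_odd_multiples[of window 6 "4 - 3 * k" t, OF window_even] False zero
        by (simp add: x_def)
      finally show ?thesis by (simp only: sum_eq)
    qed
  qed
  moreover have "infinite {j. \<bar>\<gamma> j\<bar> = 1}"
    by (rule infinite_super[OF _ infinite_residue_class[of 3 1]]) (auto simp: \<gamma>_def)
  ultimately show ?thesis
    using \<open>t > 0\<close> by (intro window_gabor_not_frame[where y = 0 and \<gamma> = \<gamma>]) (auto simp: \<gamma>_def)
qed

theorem theorem1p4:
  fixes g :: "real \<Rightarrow> complex" and a :: real
  assumes "\<And>x. g x = complex_of_real ((x\<^sup>2 - 1) / ((x\<^sup>2 + 1) * (x\<^sup>2 + 4) * (x\<^sup>2 + 9)))"
    and "a \<in> {1/3, 1/2, 2/3, 3/4}"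
  shows "\<exists>\<alpha> \<beta>. \<alpha> > 0 \<and> \<beta> > 0 \<and> \<alpha> * \<beta> = a \<and> \<not> is_frame (gabor_system g \<alpha> \<beta>)"
proof -
  have g: "g = (\<lambda>x. of_real (window x))"
    using assms(1) by (simp add: window_def fun_eq_iff)
  obtain t where t: "t > 0" "alternating_periodization window (real 4 * t) t = 0"
    using exists_alternating_periodization_zero[of 4] by auto
  obtain u where u: "u > 0" "alternating_periodization window (real 6 * u) u = 0"
    using exists_alternating_periodization_zero[of 6] by auto
  from assms(2) consider "a = 1/3" | "a = 1/2" | "a = 2/3" | "a = 3/4" by blast
  then show ?thesis
  proof cases
    case 1
    then show ?thesis unfolding g
      using window_gabor_not_frame_alternating[OF u(1) _ _ u(2), of 1] u(1)
      by (intro exI[of _ "2 * u"] exI[of _ "1 / (6 * u)"]) simp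
  next
    case 2
    then show ?thesis unfolding g
      using window_gabor_not_frame_alternating[OF t(1) _ _ t(2), of 1] t(1)
      by (intro exI[of _ "2 * t"] exI[of _ "1 / (4 * t)"]) simp
  next
    case 3
    then show ?thesis unfolding g
      using window_gabor_not_frame_alternating[OF u(1) _ _ u(2), of 2] u(1)
      by (intro exI[of _ "4 * u"] exI[of _ "1 / (6 * u)"]) simp
  next
    case 4
    then show ?thesis unfolding g
      using window_gabor_not_frame_three_quarters[of u] u
      by (intro exI[of _ "3 * u"] exI[of _ "1 / (4 * u)"]) simp
  qed
qed

end
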